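(* Let $n$ be a positive integer and let $D\subseteq[n]^2$ be the odd diagram of some permutation in $\mathfrak{S}_n$. Then the odd diagram class $\{w\in\mathfrak{S}_n : D_o(w)=D\}$ is an antichain in the right weak order on $\mathfrak{S}_n$.
   Context: $\mathfrak{S}_n$ is the symmetric group on $[n]=\{1,\dots,n\}$, with length $\ell(w)=|\{(i,j)\in[n]^2: i<j,\ w(i)>w(j)\}|$. The right weak order on $\mathfrak{S}_n$ is the partial order whose covering relations are: $u$ is covered by $v$ if and only if $v=u\,(i\ i{+}1)$ for some $1\le i\le n-1$ and $\ell(v)=\ell(u)+1$. Here $u\,(i\ i{+}1)$ is obtained from $u$ by exchanging the values in positions $i$ and $i+1$. The diagram of $w\in\mathfrak{S}_n$ is $D(w)=\{(i,j)\in[n]^2 : j<w(i),\ w^{-1}(j)>i\}$, and the odd diagram of $w$ is $D_o(w)=\{(i,j)\in D(w): i\not\equiv w^{-1}(j) \pmod 2\}$. *)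

theory Defs
  imports "HOL-Combinatorics.Permutations"
begin

text \<open>The symmetric group on \<open>{1..n}\<close> consists of the functions \<open>w :: nat \<Rightarrow> nat\<close> with
  \<open>w permutes {1..n}\<close>. Such functions fix everything outside \<open>{1..n}\<close>, so that equality
  of functions, composition and \<open>inv\<close> are equality, product and inverse in the group.\<close>

definition sym_group :: "nat \<Rightarrow> (nat \<Rightarrow> nat) set" where
  "sym_group n = {w. w permutes {1..n}}"

definition perm_length :: "nat \<Rightarrow> (nat \<Rightarrow> nat) \<Rightarrow> nat" where
  "perm_length n w = card {(i, j). i \<in> {1..n} \<and> j \<in> {1..n} \<and> i < j \<and> w i > w j}"

definition right_weak_covers :: "nat \<Rightarrow> ((nat \<Rightarrow> nat) \<times> (nat \<Rightarrow> nat)) set" where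
  "right_weak_covers n = {(u, v). u \<in> sym_group n \<and> v \<in> sym_group n \<and>
     (\<exists>i. 1 \<le> i \<and> i \<le> n - 1 \<and> v = u \<circ> transpose i (i + 1)) \<and>
     perm_length n v = perm_length n u + 1}"

text \<open>A partial order on a finite set is the reflexive transitive closure of its covering
  relation; reflexivity is restricted to \<open>sym_group n\<close>.\<close>

definition right_weak_order :: "nat \<Rightarrow> ((nat \<Rightarrow> nat) \<times> (nat \<Rightarrow> nat)) set" where
  "right_weak_order n = (right_weak_covers n)\<^sup>* \<inter> sym_group n \<times> sym_group n"

definition perm_diagram :: "nat \<Rightarrow> (nat \<Rightarrow> nat) \<Rightarrow> (nat \<times> nat) set" where
  "perm_diagram n w = {(i, j). i \<in> {1..n} \<and> j \<in> {1..n} \<and> j < w i \<and> inv w j > i}"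

definition odd_diagram :: "nat \<Rightarrow> (nat \<Rightarrow> nat) \<Rightarrow> (nat \<times> nat) set" where
  "odd_diagram n w = {(i, j) \<in> perm_diagram n w. i mod 2 \<noteq> inv w j mod 2}"

definition odd_diagram_class :: "nat \<Rightarrow> (nat \<times> nat) set \<Rightarrow> (nat \<Rightarrow> nat) set" where
  "odd_diagram_class n D = {w \<in> sym_group n. odd_diagram n w = D}"

definition antichain_on :: "('a \<times> 'a) set \<Rightarrow> 'a set \<Rightarrow> bool" where
  "antichain_on r A \<longleftrightarrow> (\<forall>u\<in>A. \<forall>v\<in>A. u \<noteq> v \<longrightarrow> (u, v) \<notin> r \<and> (v, u) \<notin> r)"

lemma right_weak_covers_trancl_length:
  assumes "(u, v) \<in> (right_weak_covers n)\<^sup>+"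
  shows "perm_length n u < perm_length n v"
  using assms by induction (auto simp: right_weak_covers_def)

lemma partial_order_on_right_weak_order:
  "partial_order_on (sym_group n) (right_weak_order n)"
proof -
  have "antisym ((right_weak_covers n)\<^sup>*)"
    by (rule antisymI) (metis less_asym right_weak_covers_trancl_length rtranclD)
  then have "antisym (right_weak_order n)"
    by (auto simp: right_weak_order_def antisym_def)
  moreover have "trans (right_weak_order n)"
    by (auto simp: right_weak_order_def intro!: transI)
  ultimately show ?thesis
    by (auto simp: partial_order_on_def preorder_on_def refl_on_def right_weak_order_def)
qed

text \<open>The prescribed covering relation is the covering relation of the order it generates.\<close>

lemma right_weak_covers_iff:
  "(u, v) \<in> right_weak_covers n \<longleftrightarrow>
     (u, v) \<in> right_weak_order n \<and> u \<noteq> v \<and>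
     (\<nexists>x. x \<noteq> u \<and> x \<noteq> v \<and> (u, x) \<in> right_weak_order n \<and> (x, v) \<in> right_weak_order n)"
  (is "?L \<longleftrightarrow> ?R")
proof
  assume L: ?L
  then have len: "perm_length n v = perm_length n u + 1"
    and mem: "u \<in> sym_group n" "v \<in> sym_group n"
    by (auto simp: right_weak_covers_def)
  have "False" if "x \<noteq> u" "x \<noteq> v" "(u, x) \<in> right_weak_order n" "(x, v) \<in> right_weak_order n" for x
  proof -
    have "(u, x) \<in> (right_weak_covers n)\<^sup>+" "(x, v) \<in> (right_weak_covers n)\<^sup>+"
      using that by (auto simp: right_weak_order_def rtrancl_eq_or_trancl)
    then show False
      using right_weak_covers_trancl_length len by (metis Suc_eq_plus1 not_less_eq)
  qed
  then show ?R
    using L mem len by (auto simp: right_weak_order_def)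
next
  assume R: ?R
  then have "(u, v) \<in> (right_weak_covers n)\<^sup>+"
    by (auto simp: right_weak_order_def rtrancl_eq_or_trancl)
  then obtain x where x: "(u, x) \<in> right_weak_covers n" "(x, v) \<in> (right_weak_covers n)\<^sup>*"
    by (blast dest: tranclD)
  then have "(u, x) \<in> right_weak_order n" "(x, v) \<in> right_weak_order n" "x \<noteq> u"
    using R by (auto simp: right_weak_order_def right_weak_covers_def)
  then show ?L
    using R x by blast
qed

end

theory Submission
  imports Defs
begin

text \<open>
  Going up in the right weak order only adds inversions when an inversion is recorded by its two
  \<^emph>\<open>values\<close>, the larger of which stands to the left of the smaller
  (\<open>right_weak_order_value_inversions\<close>). Suppose that \<open>u\<close> lies below \<open>v\<close> and that both have the
  same odd diagram. If \<open>u \<noteq> v\<close>, let \<open>c\<close> be the least value whose position changes, from \<open>p\<close> in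
  \<open>u\<close> to \<open>q\<close> in \<open>v\<close>. The smaller values stand in the same positions in both permutations, so a position
  carries a value at least \<open>c\<close> in \<open>u\<close> exactly if it does so in \<open>v\<close>.

  The value \<open>c\<close> cannot move to the left: every larger value standing before \<open>c\<close> in \<open>u\<close> must still
  do so in \<open>v\<close>, but there are fewer positions available for them
  (\<open>least_moved_value_not_left\<close>). It cannot move to the right either, and here the odd diagram
  enters: column \<open>c\<close> lists the positions to the left of \<open>c\<close>, of parity opposite to that of its
  position, whose value exceeds \<open>c\<close>. Equality of the two columns forces \<open>p\<close> and \<open>q\<close> to have the
  same parity and position \<open>p + 1\<close> to carry a value smaller than \<open>c\<close>; then \<open>c\<close> jumps over
  this smaller value and destroys an inversion (\<open>least_moved_value_not_right\<close>).
\<close>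

section \<open>Inversions along the right weak order\<close>

text \<open>If positions \<open>i\<close> and \<open>i + 1\<close> form a descent, then exchanging them removes the inversion
  \<open>(i, i + 1)\<close>, and every inversion that remains comes from one of \<open>u\<close> by the same exchange.\<close>

lemma perm_length_comp_transpose_le:
  assumes "1 \<le> i" "i \<le> n - 1" "u (i + 1) < u i"
  shows "perm_length n (u \<circ> transpose i (i + 1)) \<le> perm_length n u"
proof -
  let ?s = "transpose i (i + 1)"
  let ?Inv = "\<lambda>w :: nat \<Rightarrow> nat. {(a, b). a \<in> {1..n} \<and> b \<in> {1..n} \<and> a < b \<and> w a > w b}"
  have "card (?Inv (u \<circ> ?s)) \<le> card (?Inv u)"
  proof (rule card_inj_on_le)
    show "inj_on (map_prod ?s ?s) (?Inv (u \<circ> ?s))"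
      by (rule inj_on_subset[OF prod.inj_map]) auto
    show "map_prod ?s ?s ` ?Inv (u \<circ> ?s) \<subseteq> ?Inv u"
      using assms by (auto simp: transpose_def split: if_splits)
    show "finite (?Inv u)"
      by (rule finite_subset[of _ "{1..n} \<times> {1..n}"]) auto
  qed
  then show ?thesis
    by (simp add: perm_length_def)
qed

lemma right_weak_covers_value_inversions:
  assumes cov: "(u, v) \<in> right_weak_covers n"
    and ab: "a < b" "inv u b < inv u a"
  shows "inv v b < inv v a"
proof -
  obtain i where i: "1 \<le> i" "i \<le> n - 1" and v: "v = u \<circ> transpose i (i + 1)"
    and len: "perm_length n v = perm_length n u + 1" and u: "u permutes {1..n}"
    using cov by (auto simp: right_weak_covers_def sym_group_def)
  have ascent: "u i \<le> u (i + 1)"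
    using perm_length_comp_transpose_le[of i n u] i v len by (cases "u (i + 1) < u i") auto
  have inv_v: "inv v x = transpose i (i + 1) (inv u x)" for x
    using permutes_bij[OF u] by (simp add: v o_inv_distrib)
  (* Only the two exchanged positions change their relative order, and they form an ascent of u. *)
  have "\<not> (inv u b = i \<and> inv u a = i + 1)"
    using ascent ab(1) permutes_inverses(1)[OF u] by (metis not_le)
  then show ?thesis
    using ab(2) by (auto simp: inv_v transpose_def)
qed

lemma right_weak_order_value_inversions:
  assumes "(u, v) \<in> right_weak_order n" "a < b" "inv u b < inv u a"
  shows "inv v b < inv v a"
proof -
  have "(u, v) \<in> (right_weak_covers n)\<^sup>*"
    using assms(1) by (simp add: right_weak_order_def)
  then show ?thesis
  proof induction
    case base
    show ?case
      by (rule assms(3))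
  next
    case (step w v)
    show ?case
      using step.hyps(2) assms(2) step.IH by (rule right_weak_covers_value_inversions)
  qed
qed

section \<open>The least value that changes its position\<close>

text \<open>The larger values before \<open>c\<close> in \<open>u\<close> occupy all positions to the left of \<open>c\<close> that do not
  carry a smaller value. If \<open>c\<close> moved to the left, then the position that it moves to would be
  lost, so these values could not all remain before \<open>c\<close>.\<close>

lemma least_moved_value_not_left:
  fixes u v :: "nat \<Rightarrow> nat"
  assumes u: "bij u" and v: "bij v"
    and mono: "\<And>b. c < b \<Longrightarrow> inv u b < inv u c \<Longrightarrow> inv v b < inv v c"
    and same: "\<And>a. a < c \<Longrightarrow> inv u a = inv v a"
  shows "inv u c \<le> inv v c"
proof (rule ccontr)
  assume "\<not> inv u c \<le> inv v c"
  then have less: "inv v c < inv u c"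
    by simp
  let ?U = "{i. i < inv u c \<and> c < u i}" and ?V = "{i. i < inv v c \<and> c < v i}"
  have uv[simp]: "u (inv u x) = x" "v (inv v x) = x" "inv u (u x) = x" "inv v (v x) = x" for x
    using u v by (simp_all add: bij_is_surj surj_f_inv_f bij_is_inj)
  have small: "v i = u i" if "u i < c" for i
    using arg_cong[OF same[OF that], of v] by simp
  have "inv v ` u ` ?U \<subseteq> ?V"
    using mono by auto
  then have "card (inv v ` u ` ?U) \<le> card ?V"
    by (intro card_mono) auto
  moreover have "card (inv v ` u ` ?U) = card ?U"
    using u v by (simp add: card_image inj_on_subset[OF bij_is_inj] bij_imp_bij_inv)
  moreover have "?V \<subset> ?U"
  proof
    show "?V \<subseteq> ?U"
    proof safe
      fix i assume i: "i < inv v c" "c < v i"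
      then show *: "i < inv u c"
        using less by simp
      have "u i \<noteq> c"
        using * by auto
      then show "c < u i"
        using i(2) small[of i] by (cases "u i < c") auto
    qed
    have "u (inv v c) \<noteq> c"
      using less by (metis less_irrefl uv(3))
    then have "c < u (inv v c)"
      using small[of "inv v c"] by (cases "u (inv v c) < c") auto
    then show "?V \<noteq> ?U"
      using less by blast
  qed
  then have "card ?V < card ?U"
    by (intro psubset_card_mono) auto
  ultimately show False
    by simp
qed

text \<open>Suppose that \<open>c\<close> moved to the right, from \<open>p\<close> to \<open>q\<close>. Position \<open>p\<close> carries a larger value
  in \<open>v\<close> and is not in column \<open>c\<close> for \<open>u\<close>, so it must be excluded from column \<open>c\<close> for \<open>v\<close> by
  parity. Position \<open>p + 1\<close> then has the parity that counts, and is excluded only by carrying a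
  value below \<open>c\<close>.\<close>

lemma least_moved_value_not_right:
  assumes u: "u permutes {1..n}" and v: "v permutes {1..n}"
    and mono: "\<And>a. a < c \<Longrightarrow> inv u c < inv u a \<Longrightarrow> inv v c < inv v a"
    and same: "\<And>a. a < c \<Longrightarrow> inv u a = inv v a"
    and diag: "odd_diagram n u = odd_diagram n v"
    and c: "c \<in> {1..n}"
  shows "inv v c \<le> inv u c"
proof (rule ccontr)
  define p q where "p = inv u c" and "q = inv v c"
  assume "\<not> inv v c \<le> inv u c"
  then have pq: "p < q"
    by (simp add: p_def q_def)
  have uv[simp]: "u (inv u x) = x" "v (inv v x) = x" "inv u (u x) = x" "inv v (v x) = x" for x
    using permutes_inverses[OF u] permutes_inverses[OF v] by auto
  have p: "p \<in> {1..n}" and q: "q \<in> {1..n}"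
    using c permutes_in_image[OF permutes_inv[OF u]] permutes_in_image[OF permutes_inv[OF v]]
    by (auto simp: p_def q_def)
  have col: "i < p" if "i \<in> {1..n}" "c < v i" "i < q" "i mod 2 \<noteq> q mod 2" for i
  proof -
    have "(i, c) \<in> odd_diagram n v"
      using that c by (simp add: odd_diagram_def perm_diagram_def q_def)
    then show ?thesis
      unfolding diag[symmetric] by (simp add: odd_diagram_def perm_diagram_def p_def)
  qed
  have small: "u i = v i" if "v i < c" for i
    using arg_cong[OF same[OF that], of u] by simp
  have "v p \<noteq> c"
    using pq by (auto simp: q_def)
  then have "c < v p"
    using small[of p] by (cases "v p < c") (auto simp: p_def)
  then have parity: "p mod 2 = q mod 2"
    using col[of p] p pq by auto
  then have next_parity: "(p + 1) mod 2 \<noteq> q mod 2"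
    by presburger
  then have next_q: "p + 1 < q"
    using pq by (cases "p + 1 = q") auto
  then have "\<not> c < v (p + 1)"
    using col[of "p + 1"] next_parity q by auto
  moreover have "v (p + 1) \<noteq> c"
    using next_q by (auto simp: q_def)
  ultimately have a: "v (p + 1) < c"
    by simp
  then have "inv u (v (p + 1)) = p + 1"
    using small uv(3)[of "p + 1"] by simp
  then have "inv v c < p + 1"
    using mono[OF a] by (simp add: p_def)
  then show False
    using next_q by (simp add: q_def)
qed

lemma right_weak_order_odd_diagram_eq:
  assumes le: "(u, v) \<in> right_weak_order n" and diag: "odd_diagram n u = odd_diagram n v"
  shows "u = v"
proof -
  have u: "u permutes {1..n}" and v: "v permutes {1..n}"
    using le by (auto simp: right_weak_order_def sym_group_def)
  note mono = right_weak_order_value_inversions[OF le]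
  have "inv u c = inv v c" for c
  proof (induction c rule: less_induct)
    case (less c)
    show ?case
    proof (cases "c \<in> {1..n}")
      case True
      have "inv u c \<le> inv v c"
        by (rule least_moved_value_not_left[OF permutes_bij[OF u] permutes_bij[OF v]])
          (erule (1) mono, erule less)
      moreover have "inv v c \<le> inv u c"
        by (rule least_moved_value_not_right[OF u v _ _ diag True])
          (erule (1) mono, erule less)
      ultimately show ?thesis
        by simp
    next
      case False
      then show ?thesis
        using permutes_not_in[OF permutes_inv[OF u]] permutes_not_in[OF permutes_inv[OF v]]
        by simp
    qed
  qed
  then have "inv (inv u) = inv (inv v)"
    by (metis ext)
  then show ?thesis
    by (simp only: permutes_inv_inv[OF u] permutes_inv_inv[OF v])
qed

theorem corollary6p11:
  fixes n :: nat and D :: "(nat \<times> nat) set"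
  assumes "n > 0"
    and "D \<subseteq> {1..n} \<times> {1..n}"
    and "\<exists>w \<in> sym_group n. odd_diagram n w = D"
  shows "antichain_on (right_weak_order n) (odd_diagram_class n D)"
proof -
  have "(u, v) \<notin> right_weak_order n"
    if "u \<in> odd_diagram_class n D" "v \<in> odd_diagram_class n D" "u \<noteq> v" for u v
    using that right_weak_order_odd_diagram_eq[of u v n] by (auto simp: odd_diagram_class_def)
  then show ?thesis
    by (simp add: antichain_on_def)
qed

end
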